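(* Let $h:\mathbf{C}\to\mathbf{C}$ be a chaotic homeomorphism of the Cantor space. Then there exist $\Phi=(\varphi^L,\varphi^U)$ such that $\mathbf{F}_\Phi$ is a Lelek fence and a chaotic homeomorphism $\hat h$ of $\mathbf{F}_\Phi$ such that $h$ is the canonical factor of $\hat h$, i.e. $\hat h(y,t)=(h(y),s)$ for some $s$, for all $(y,t)\in\mathbf{F}_\Phi$.
   Context: A map is chaotic (in the sense of Devaney) if it is transitive and its periodic points are dense. For $\Phi=(\varphi^L,\varphi^U)$ with $\varphi^L,\varphi^U:\mathbf{C}\to[0,1]$, $\varphi^L$ lower semicontinuous, $\varphi^U$ upper semicontinuous, $\varphi^L\le\varphi^U$, the fence is $\mathbf{F}_\Phi=\{(x,t)\in\mathbf{C}\times[0,1]:\varphi^L(x)\le t\le\varphi^U(x)\}$. $\mathbf{F}_\Phi$ is a Lelek fence if $\varphi^L\equiv0$, $\varphi^U$ is positive on a dense subset of $\mathbf{C}$, and the graph $\{(x,\varphi^U(x)):x\in\mathbf{C}\}$ is dense in $\mathbf{F}_\Phi$. *)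

theory Defs
  imports "HOL-Analysis.Analysis"
begin

text \<open>The Cantor space, modelled as the standard middle-thirds Cantor set in [0,1].\<close>
definition cantor_set :: "real set" where
  "cantor_set = {x. \<exists>d::nat \<Rightarrow> real. (\<forall>n. d n \<in> {0, 2}) \<and> x = (\<Sum>n. d n / 3 ^ Suc n)}"

definition lower_semicont_on :: "'a::topological_space set \<Rightarrow> ('a \<Rightarrow> real) \<Rightarrow> bool" where
  "lower_semicont_on S f \<longleftrightarrow> (\<forall>a. openin (top_of_set S) {x \<in> S. a < f x})"

definition upper_semicont_on :: "'a::topological_space set \<Rightarrow> ('a \<Rightarrow> real) \<Rightarrow> bool" where
  "upper_semicont_on S f \<longleftrightarrow> (\<forall>a. openin (top_of_set S) {x \<in> S. f x < a})"

definition transitive_on :: "'a::topological_space set \<Rightarrow> ('a \<Rightarrow> 'a) \<Rightarrow> bool" where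
  "transitive_on X f \<longleftrightarrow>
     (\<forall>U V. openin (top_of_set X) U \<and> openin (top_of_set X) V \<and> U \<noteq> {} \<and> V \<noteq> {}
        \<longrightarrow> (\<exists>n>0. (f ^^ n) ` U \<inter> V \<noteq> {}))"

definition periodic_points :: "'a set \<Rightarrow> ('a \<Rightarrow> 'a) \<Rightarrow> 'a set" where
  "periodic_points X f = {x \<in> X. \<exists>n>0. (f ^^ n) x = x}"

text \<open>Chaos in the sense of Devaney: transitive with dense periodic points.\<close>
definition chaotic_on :: "'a::topological_space set \<Rightarrow> ('a \<Rightarrow> 'a) \<Rightarrow> bool" where
  "chaotic_on X f \<longleftrightarrow> transitive_on X f \<and> X \<subseteq> closure (periodic_points X f)"

definition fence :: "(real \<Rightarrow> real) \<Rightarrow> (real \<Rightarrow> real) \<Rightarrow> (real \<times> real) set" where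
  "fence phiL phiU = {(x, t). x \<in> cantor_set \<and> phiL x \<le> t \<and> t \<le> phiU x}"

definition admissible_pair :: "(real \<Rightarrow> real) \<Rightarrow> (real \<Rightarrow> real) \<Rightarrow> bool" where
  "admissible_pair phiL phiU \<longleftrightarrow>
     (\<forall>x \<in> cantor_set. 0 \<le> phiL x \<and> phiL x \<le> phiU x \<and> phiU x \<le> 1) \<and>
     lower_semicont_on cantor_set phiL \<and> upper_semicont_on cantor_set phiU"

definition lelek_fence :: "(real \<Rightarrow> real) \<Rightarrow> (real \<Rightarrow> real) \<Rightarrow> bool" where
  "lelek_fence phiL phiU \<longleftrightarrow>
     (\<forall>x \<in> cantor_set. phiL x = 0) \<and>
     (\<exists>D \<subseteq> cantor_set. cantor_set \<subseteq> closure D \<and> (\<forall>x \<in> D. 0 < phiU x)) \<and>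
     fence phiL phiU \<subseteq> closure ((\<lambda>x. (x, phiU x)) ` cantor_set)"

end

theory Submission
  imports Defs
begin

text \<open>
  Let \<open>\<phi> = exp (- \<Sum>k. u\<^sub>k)\<close> with continuous \<open>u\<^sub>k \<ge> 0\<close> satisfying \<open>\<bar>u\<^sub>k \<circ> h - u\<^sub>k\<bar> \<le> 2\<^sup>-\<^sup>k\<close>.
  Then \<open>\<phi>\<close> is upper semicontinuous and \<open>\<phi> \<circ> h = c \<phi>\<close> for the continuous positive function
  \<open>c = exp (- \<Sum>k. (u\<^sub>k \<circ> h - u\<^sub>k))\<close>, so that \<open>(y, t) \<mapsto> (h y, c y t)\<close> is a homeomorphism of the
  region under the graph of \<open>\<phi>\<close>, and it maps \<open>(y, \<phi> y)\<close> to \<open>(h y, \<phi> (h y))\<close>. The Lelek property,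
  transitivity and density of periodic points all follow if any two points of the region can be
  approximated simultaneously by \<open>(y, \<phi> y)\<close> and \<open>(h\<^sup>n y, \<phi> (h\<^sup>n y))\<close> with \<open>y\<close> periodic. This is a
  countable list of requirements, and each \<open>u\<^sub>k\<close> meets one of them: chaos of \<open>h\<close> provides \<open>y\<close> and
  \<open>n\<close>, and \<open>u\<^sub>k\<close> lowers the graph at \<open>y\<close> and \<open>h\<^sup>n y\<close> to the required heights, falling off slowly
  along orbits and vanishing at the finitely many points used before.
\<close>

section \<open>Continuous functions and rational exponents\<close>

lemma continuous_on_Max:
  fixes f :: "'i \<Rightarrow> 'a::topological_space \<Rightarrow> real"
  assumes "finite I" "I \<noteq> {}" "\<And>i. i \<in> I \<Longrightarrow> continuous_on S (f i)"
  shows "continuous_on S (\<lambda>x. Max ((\<lambda>i. f i x) ` I))"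
  using assms
proof (induction I rule: finite_ne_induct)
  case (insert i I)
  have "(\<lambda>x. Max ((\<lambda>i. f i x) ` insert i I)) = (\<lambda>x. max (f i x) (Max ((\<lambda>i. f i x) ` I)))"
    using insert.hyps by auto
  then show ?case
    using insert by (auto intro!: continuous_on_max)
qed auto

lemma openin_continuous_greater:
  fixes f :: "'a::topological_space \<Rightarrow> real"
  assumes "continuous_on S f"
  shows "openin (top_of_set S) {x \<in> S. a < f x}"
  using continuous_openin_preimage_gen[OF assms, of "{a<..}"]
  by (simp add: vimage_def Int_def)

lemma openin_continuous_less:
  fixes f :: "'a::topological_space \<Rightarrow> real"
  assumes "continuous_on S f"
  shows "openin (top_of_set S) {x \<in> S. f x < a}"
  using continuous_openin_preimage_gen[OF assms, of "{..<a}"]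
  by (simp add: vimage_def Int_def)

lemma exists_rational_exponent:
  fixes s \<epsilon> :: real
  assumes "0 \<le> s" "s \<le> 1" "0 < \<epsilon>"
  obtains a where "a \<in> \<rat>" "\<bar>exp (- a) - s\<bar> < \<epsilon>" "0 < s \<Longrightarrow> exp (- a) < s"
proof -
  \<comment> \<open>The value \<open>exp (- a)\<close> is to lie between \<open>lo\<close> and
    \<open>hi\<close>. The term \<open>hi / 2\<close> keeps \<open>lo\<close> positive, so that its
    logarithm makes sense; \<open>hi - \<epsilon>\<close> controls the error when \<open>s\<close>
    is positive.\<close>
  define hi where "hi = (if 0 < s then s else \<epsilon>)"
  define lo where "lo = max (hi / 2) (hi - \<epsilon>)"
  have "0 < lo" "lo < hi"
    using assms by (auto simp: lo_def hi_def)
  then have "- ln hi < - ln lo"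
    by simp
  then obtain a where a: "a \<in> \<rat>" "- ln hi < a" "a < - ln lo"
    using Rats_dense_in_real by blast
  have "exp (- a) < exp (ln hi)" "exp (ln lo) < exp (- a)"
    using a by auto
  then have "exp (- a) < hi" "lo < exp (- a)"
    using \<open>0 < lo\<close> \<open>lo < hi\<close> by auto
  then show thesis
    using assms a(1) that[of a] by (auto simp: lo_def hi_def split: if_splits)
qed

section \<open>Integer iterates of a chaotic homeomorphism\<close>

locale chaotic_homeomorphism =
  fixes C :: "'a::{metric_space, second_countable_topology} set" and h g :: "'a \<Rightarrow> 'a"
  assumes homeo: "homeomorphism C C h g"
    and chaotic: "chaotic_on C h"
    and perfect: "x \<in> C \<Longrightarrow> x islimpt C"
    and nonempty: "C \<noteq> {}"
begin

text \<open>Negative powers are included because a tent falls off along orbits in both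
  directions.\<close>

definition iter :: "int \<Rightarrow> 'a \<Rightarrow> 'a" where
  "iter i = (if 0 \<le> i then h ^^ nat i else g ^^ nat (- i))"

lemma h_in: "x \<in> C \<Longrightarrow> h x \<in> C" and g_in: "x \<in> C \<Longrightarrow> g x \<in> C"
  and g_h: "x \<in> C \<Longrightarrow> g (h x) = x" and h_g: "x \<in> C \<Longrightarrow> h (g x) = x"
  and continuous_h: "continuous_on C h" and continuous_g: "continuous_on C g"
  using homeo by (auto simp: homeomorphism_def)

lemma funpow_h_in: "x \<in> C \<Longrightarrow> (h ^^ n) x \<in> C"
  by (induction n) (auto simp: h_in)

lemma funpow_g_in: "x \<in> C \<Longrightarrow> (g ^^ n) x \<in> C"
  by (induction n) (auto simp: g_in)

lemma continuous_on_funpow: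
  assumes "continuous_on C f" "\<And>x. x \<in> C \<Longrightarrow> f x \<in> C"
  shows "continuous_on C (f ^^ n)"
proof (induction n)
  case (Suc n)
  have "(f ^^ n) ` C \<subseteq> C"
    using assms(2) by (induction n) auto
  then show ?case
    using continuous_on_compose[OF Suc continuous_on_subset[OF assms(1)]] by simp
qed (auto simp: id_def)

lemma iter_in: "x \<in> C \<Longrightarrow> iter i x \<in> C"
  by (simp add: iter_def funpow_h_in funpow_g_in)

lemma continuous_on_iter: "continuous_on C (iter i)"
  by (simp add: iter_def continuous_on_funpow continuous_h continuous_g h_in g_in)

lemma iter_h: "iter i (h x) = iter (i + 1) x" if "x \<in> C"
proof (cases "0 \<le> i")
  case True
  then show ?thesis
    by (simp add: iter_def nat_add_distrib funpow_swap1)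
next
  case False
  then have "nat (- i) = Suc (nat (- (i + 1)))"
    by simp
  then show ?thesis
    using False that
    by (auto simp: iter_def funpow_swap1 funpow_Suc_right g_h simp del: funpow.simps)
qed

lemma iter_uminus_iter: "iter (- i) (iter i x) = x" if "x \<in> C"
proof -
  have "(g ^^ n) ((h ^^ n) y) = y \<and> (h ^^ n) ((g ^^ n) y) = y" if "y \<in> C" for n y
    using that by (induction n arbitrary: y)
      (simp_all add: funpow_h_in funpow_g_in g_h h_g funpow_swap1 h_in g_in)
  then show ?thesis
    using that by (auto simp: iter_def)
qed

section \<open>Bumps that vary slowly along orbits\<close>

text \<open>This lets points of an open set be chosen off any finite set of forbidden
  points.\<close>

lemma infinite_openin:
  assumes "openin (top_of_set C) A" "A \<noteq> {}"
  shows "infinite A"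
proof -
  obtain x where "x \<in> A"
    using assms(2) by blast
  obtain T where "open T" "A = C \<inter> T"
    using assms(1) by (auto simp: openin_open)
  then show ?thesis
    using perfect[of x] \<open>x \<in> A\<close> by (auto simp: islimpt_eq_acc_point Int_commute)
qed

text \<open>The tent is the Lipschitz envelope along orbits of a bump \<open>b\<close> at \<open>e\<close>; the terms
  with \<open>\<bar>i\<bar> > M\<close> of the full supremum are nonpositive.\<close>

lemma tent:
  assumes e: "e \<in> C" and T: "finite T" "T \<subseteq> C"
    and far: "\<And>i. \<bar>i\<bar> \<le> int M \<Longrightarrow> iter i e \<notin> T"
    and K: "0 \<le> K" "K \<le> \<delta> * real M" and "0 < \<delta>"
  obtains u where "continuous_on C u" "\<And>z. z \<in> C \<Longrightarrow> 0 \<le> u z" "u e = K"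
    "\<And>z. z \<in> T \<Longrightarrow> u z = 0" "\<And>z. z \<in> C \<Longrightarrow> \<bar>u (h z) - u z\<bar> \<le> \<delta>"
proof -
  define I where "I = {- int M..int M}"
  have I: "finite I" "I \<noteq> {}" "0 \<in> I" "\<And>i. i \<in> I \<longleftrightarrow> \<bar>i\<bar> \<le> int M"
    by (auto simp: I_def)
  \<comment> \<open>A bump that vanishes on \<open>T'\<close> contributes nothing to the tent at
    points of \<open>T\<close>. Since \<open>I\<close> is symmetric, \<open>far\<close> says exactly
    that \<open>e\<close> is not in \<open>T'\<close>.\<close>
  define T' where "T' = (\<Union>i\<in>I. iter i ` T)"
  have "finite T'"
    by (auto simp: T'_def I T)
  have "e \<notin> T'"
  proof
    assume "e \<in> T'"
    then obtain i t where it: "i \<in> I" "t \<in> T" "e = iter i t"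
      by (auto simp: T'_def)
    then have "iter (- i) e = t"
      using iter_uminus_iter T by auto
    then show False
      using far[of "- i"] it I(4) by auto
  qed
  then obtain d where d: "d > 0" "\<And>x. x \<in> T' \<Longrightarrow> d \<le> dist e x"
    using finite_set_avoid[OF \<open>finite T'\<close>, of e] by metis
  define b where "b z = K * max 0 (1 - dist e z / d)" for z
  have b_bounds: "0 \<le> b z" "b z \<le> K" for z
    using K(1) d(1) by (auto simp: b_def intro!: mult_left_le)
  have "continuous_on UNIV b"
    unfolding b_def using d(1) by (intro continuous_intros) auto
  define u where "u z = Max ((\<lambda>i. b (iter i z) - \<delta> * \<bar>real_of_int i\<bar>) ` I)" for z
  have u_ge: "b (iter i z) - \<delta> * \<bar>real_of_int i\<bar> \<le> u z" if "i \<in> I" for i z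
    using that I by (auto simp: u_def)
  have u_le: "u z \<le> c" if "\<And>i. i \<in> I \<Longrightarrow> b (iter i z) - \<delta> * \<bar>real_of_int i\<bar> \<le> c" for c z
    using that I by (auto simp: u_def)
  have u_nonneg: "0 \<le> u z" for z
    using u_ge[OF I(3), of z] b_bounds(1)[of "iter 0 z"] by simp
  have far_terms: "b z - \<delta> * \<bar>real_of_int i\<bar> \<le> 0" if "\<bar>i\<bar> \<ge> int M" for i z
  proof -
    have "\<delta> * real M \<le> \<delta> * \<bar>real_of_int i\<bar>"
      using that \<open>0 < \<delta>\<close> by (intro mult_left_mono) linarith+
    then show ?thesis
      using b_bounds(2)[of z] K(2) by linarith
  qed
  \<comment> \<open>Passing from \<open>z\<close> to \<open>h z\<close> shifts the index by one and
    may leave \<open>I\<close>, so the bound is needed for every integer.\<close>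
  have all_terms: "b (iter i z) - \<delta> * \<bar>real_of_int i\<bar> \<le> u z" for i z
    using u_ge[of i z] far_terms[of i "iter i z"] u_nonneg[of z] I(4)[of i] by linarith
  show thesis
  proof
    have "continuous_on C (\<lambda>z. b (iter i z))" for i
      using continuous_on_compose2[OF \<open>continuous_on UNIV b\<close> continuous_on_iter] by simp
    then show "continuous_on C u"
      unfolding u_def using I by (intro continuous_on_Max continuous_intros) auto
    show "0 \<le> u z" for z
      by (rule u_nonneg)
    show "u e = K"
    proof (rule antisym)
      have "0 \<le> \<delta> * \<bar>real_of_int i\<bar>" for i
        using \<open>0 < \<delta>\<close> by simp
      then show "u e \<le> K"
        by (intro u_le) (smt (verit) b_bounds(2))
      show "K \<le> u e"
        using u_ge[OF I(3), of e] by (simp add: iter_def b_def)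
    qed
    show "u z = 0" if "z \<in> T" for z
    proof (rule antisym)
      have "b (iter i z) = 0" if "i \<in> I" for i
      proof -
        have "d \<le> dist e (iter i z)"
          using that \<open>z \<in> T\<close> by (intro d(2)) (auto simp: T'_def)
        then show ?thesis
          using d(1) by (simp add: b_def)
      qed
      then show "u z \<le> 0"
        using \<open>0 < \<delta>\<close> by (intro u_le) auto
    qed (rule u_nonneg)
    show "\<bar>u (h z) - u z\<bar> \<le> \<delta>" if "z \<in> C" for z
    proof -
      have step: "\<delta> * \<bar>real_of_int i\<bar> \<le> \<delta> * \<bar>real_of_int j\<bar> + \<delta>" if "\<bar>i - j\<bar> \<le> 1" for i j
      proof -
        have "\<bar>real_of_int i\<bar> \<le> \<bar>real_of_int j\<bar> + 1"
          using that by linarith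
        then show ?thesis
          using \<open>0 < \<delta>\<close> mult_left_mono[of "\<bar>real_of_int i\<bar>" "\<bar>real_of_int j\<bar> + 1" \<delta>]
          by (simp add: algebra_simps)
      qed
      \<comment> \<open>The term with index \<open>i\<close> at \<open>h z\<close> has the same bump
        value as the term with index \<open>i + 1\<close> at \<open>z\<close>; the two penalties
        differ by at most \<open>\<delta>\<close>.\<close>
      have "u (h z) \<le> u z + \<delta>"
      proof (rule u_le)
        fix i
        show "b (iter i (h z)) - \<delta> * \<bar>real_of_int i\<bar> \<le> u z + \<delta>"
          using all_terms[of "i + 1" z] step[of "i + 1" i] iter_h[OF that, of i] by simp
      qed
      moreover have "u z \<le> u (h z) + \<delta>"
      proof (rule u_le)
        fix i
        show "b (iter i z) - \<delta> * \<bar>real_of_int i\<bar> \<le> u (h z) + \<delta>"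
          using all_terms[of "i - 1" "h z"] step[of "i - 1" i] iter_h[OF that, of "i - 1"] by simp
      qed
      ultimately show ?thesis
        by linarith
    qed
  qed
qed

section \<open>Meeting a single requirement\<close>

text \<open>Transitivity makes the part of \<open>A\<close> that \<open>h ^^ n\<close> sends into
  \<open>B\<close> nonempty for some positive \<open>n\<close>. This part is relatively open, so it
  contains a periodic point.\<close>

lemma periodic_visit:
  assumes "openin (top_of_set C) A" "A \<noteq> {}" "openin (top_of_set C) B" "B \<noteq> {}"
  obtains y n where "y \<in> A" "(h ^^ n) y \<in> B" "n > 0" "y \<in> periodic_points C h"
proof -
  obtain n where n: "n > 0" "(h ^^ n) ` A \<inter> B \<noteq> {}"
    using chaotic assms unfolding chaotic_on_def transitive_on_def by metis
  define G where "G = A \<inter> (C \<inter> (h ^^ n) -` B)"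
  have "openin (top_of_set C) G"
    unfolding G_def
    using continuous_openin_preimage[OF continuous_on_funpow[OF continuous_h h_in], of n C B] assms
    by (auto simp: funpow_h_in)
  then obtain T where T: "open T" "G = C \<inter> T"
    by (auto simp: openin_open)
  have "A \<subseteq> C"
    using assms(1) openin_imp_subset by blast
  then have "G \<noteq> {}"
    using n(2) by (auto simp: G_def)
  then obtain x where "x \<in> C" "x \<in> T"
    using T by blast
  then have "x \<in> closure (periodic_points C h)"
    using chaotic by (auto simp: chaotic_on_def)
  then obtain y where "y \<in> periodic_points C h" "y \<in> T"
    using \<open>x \<in> T\<close> \<open>open T\<close> by (meson closure_iff_nhds_not_empty disjoint_iff subset_refl)
  moreover from this have "y \<in> G"
    by (auto simp: T periodic_points_def)
  ultimately show thesis
    using that[of y n] n by (auto simp: G_def)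
qed

text \<open>The function \<open>u\<close> is a sum of two tents, at \<open>y\<close> and at
  \<open>(h ^^ n) y\<close>. Neither tent may disturb the other or \<open>Q\<close>, so the two
  points must be separated from each other and from \<open>Q\<close> by more than \<open>M\<close>
  steps of the orbit. There is no control over \<open>n\<close>, hence \<open>A\<close> and
  \<open>B\<close> are shrunk beforehand so that any visit from one to the other is separated in
  this way.\<close>

lemma one_step:
  assumes A: "openin (top_of_set C) A" "A \<noteq> {}" and B: "openin (top_of_set C) B" "B \<noteq> {}"
    and Q: "finite Q" "Q \<subseteq> C" and "0 < \<delta>"
    and f: "\<And>z. z \<in> C \<Longrightarrow> 0 \<le> f z \<and> f z \<le> (K::real)" "\<And>z. z \<in> C \<Longrightarrow> 0 \<le> f' z \<and> f' z \<le> K"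
  obtains u y n where "continuous_on C u" "\<And>z. z \<in> C \<Longrightarrow> 0 \<le> u z"
    "\<And>z. z \<in> Q \<Longrightarrow> u z = 0" "\<And>z. z \<in> C \<Longrightarrow> \<bar>u (h z) - u z\<bar> \<le> \<delta>"
    "y \<in> A" "(h ^^ n) y \<in> B" "n > 0" "y \<in> periodic_points C h"
    "u y = f y" "u ((h ^^ n) y) = f' ((h ^^ n) y)"
proof -
  \<comment> \<open>With \<open>M\<close> steps on each side, a tent of slope
    \<open>\<delta> / 2\<close> can reach any height up to \<open>K\<close>.\<close>
  obtain M where "K / (\<delta> / 2) \<le> real M"
    using real_arch_simple by blast
  then have M: "K \<le> \<delta> / 2 * real M"
    using \<open>0 < \<delta>\<close> by (simp add: field_simps)
  define I where "I = {- int M..int M}"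
  have I: "finite I" "\<And>i. i \<in> I \<longleftrightarrow> \<bar>i\<bar> \<le> int M"
    by (auto simp: I_def)
  \<comment> \<open>Points off \<open>R\<close> do not meet \<open>Q\<close> within \<open>M\<close>
    steps in either direction.\<close>
  define R where "R = (\<Union>i\<in>I. iter i ` Q)"
  have R: "finite R" "R \<subseteq> C"
    using I Q iter_in by (auto simp: R_def)
  have sub: "A \<subseteq> C" "B \<subseteq> C"
    using A(1) B(1) openin_imp_subset by blast+
  obtain p where p: "p \<in> A" "p \<notin> R"
    using infinite_openin[OF A] R(1) by (meson finite_subset subsetI)
  obtain q where q: "q \<in> B" "q \<notin> R \<union> (\<lambda>i. iter i p) ` I"
    using infinite_openin[OF B] R(1) I(1) by (meson finite_UnI finite_imageI finite_subset subsetI)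
  obtain d where d: "d > 0" "\<And>i. i \<in> I \<Longrightarrow> d \<le> dist q (iter i p)"
    using finite_set_avoid[of "(\<lambda>i. iter i p) ` I" q] I(1) q
    by (metis UnI2 finite_imageI imageI)
  \<comment> \<open>At \<open>p\<close> the distances to \<open>q\<close> are at least
    \<open>d\<close>; halving \<open>d\<close> gives open conditions around \<open>p\<close> and
    \<open>q\<close> that still exclude \<open>iter i y = y'\<close> for all \<open>i\<close> in
    \<open>I\<close>.\<close>
  define A' where "A' = A \<inter> (C - R) \<inter> {x \<in> C. \<forall>i\<in>I. d / 2 < dist q (iter i x)}"
  define B' where "B' = B \<inter> (C - R) \<inter> {x \<in> C. dist q x < d / 2}"
  have CR: "openin (top_of_set C) (C - R)"
    using R by (simp add: finite_imp_closedin openin_diff)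
  have "openin (top_of_set C) {x \<in> C. \<forall>i\<in>I. d / 2 < dist q (iter i x)}"
  proof -
    have "openin (top_of_set C) (\<Inter>i\<in>I. {x \<in> C. d / 2 < dist q (iter i x)})"
      using I by (intro openin_INT2 openin_continuous_greater continuous_intros continuous_on_iter)
        (auto simp: I_def)
    moreover have "(\<Inter>i\<in>I. {x \<in> C. d / 2 < dist q (iter i x)})
        = {x \<in> C. \<forall>i\<in>I. d / 2 < dist q (iter i x)}"
      by (auto simp: I_def)
    ultimately show ?thesis
      by simp
  qed
  then have A': "openin (top_of_set C) A'"
    unfolding A'_def using A CR by (intro openin_Int)
  have B': "openin (top_of_set C) B'"
    unfolding B'_def using B CR
    by (intro openin_Int openin_continuous_less continuous_intros)
  have "p \<in> A'"
    using p sub d by (force simp: A'_def)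
  moreover have "q \<in> B'"
    using q sub d by (auto simp: B'_def)
  ultimately obtain y n where y: "y \<in> A'" "(h ^^ n) y \<in> B'" "n > 0" "y \<in> periodic_points C h"
    using periodic_visit[OF A' _ B'] by blast
  define y' where "y' = (h ^^ n) y"
  have yC: "y \<in> C" "y' \<in> C"
    using y sub by (auto simp: A'_def B'_def y'_def)
  have inverse: "x = iter (- i) w" if "w = iter i x" "x \<in> C" for i x w
    using that iter_uminus_iter by auto
  have yy': "iter i y \<noteq> y'" if "i \<in> I" for i
    using y that by (fastforce simp: A'_def B'_def y'_def)
  have y'y: "iter i y' \<noteq> y" if "\<bar>i\<bar> \<le> int M" for i
    using yy'[of "- i"] inverse[of y i y'] yC that I(2) by auto
  have RQ: "iter i x \<notin> Q" if "x \<in> C - R" "\<bar>i\<bar> \<le> int M" for i x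
    using that inverse[of _ i x] I(2)[of "- i"] by (force simp: R_def)
  have yR: "y \<in> C - R" "y' \<in> C - R"
    using y by (auto simp: A'_def B'_def y'_def)
  \<comment> \<open>Each tent gets half of \<open>\<delta>\<close> and vanishes at the peak of the
    other, so the sum keeps both prescribed values.\<close>
  obtain u1 where u1: "continuous_on C u1" "\<And>z. z \<in> C \<Longrightarrow> 0 \<le> u1 z" "u1 y = f y"
    "\<And>z. z \<in> insert y' Q \<Longrightarrow> u1 z = 0" "\<And>z. z \<in> C \<Longrightarrow> \<bar>u1 (h z) - u1 z\<bar> \<le> \<delta> / 2"
  proof (rule tent[of y "insert y' Q" M "f y" "\<delta> / 2"])
    show "iter i y \<notin> insert y' Q" if "\<bar>i\<bar> \<le> int M" for i
      using that yy' RQ[OF yR(1)] I(2) by auto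
    show "f y \<le> \<delta> / 2 * real M"
      using f(1)[OF yC(1)] M by linarith
  qed (use yC Q f \<open>0 < \<delta>\<close> in auto)
  obtain u2 where u2: "continuous_on C u2" "\<And>z. z \<in> C \<Longrightarrow> 0 \<le> u2 z" "u2 y' = f' y'"
    "\<And>z. z \<in> insert y Q \<Longrightarrow> u2 z = 0" "\<And>z. z \<in> C \<Longrightarrow> \<bar>u2 (h z) - u2 z\<bar> \<le> \<delta> / 2"
  proof (rule tent[of y' "insert y Q" M "f' y'" "\<delta> / 2"])
    show "iter i y' \<notin> insert y Q" if "\<bar>i\<bar> \<le> int M" for i
      using that y'y RQ[OF yR(2)] I(2) by auto
    show "f' y' \<le> \<delta> / 2 * real M"
      using f(2)[OF yC(2)] M by linarith
  qed (use yC Q f \<open>0 < \<delta>\<close> in auto)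
  show thesis
  proof (rule that[of "\<lambda>z. u1 z + u2 z" y n])
    show "\<bar>u1 (h z) + u2 (h z) - (u1 z + u2 z)\<bar> \<le> \<delta>" if "z \<in> C" for z
      using u1(5)[OF that] u2(5)[OF that] by linarith
  qed (use u1 u2 y in \<open>auto simp: A'_def B'_def y'_def intro!: continuous_on_add\<close>)
qed

text \<open>The conclusion \<open>\<psi> y < a\<close>, when attainable in \<open>A\<close>, makes the new height exactly \<open>exp (- a)\<close>.\<close>

definition raised :: "'a set \<Rightarrow> real \<Rightarrow> ('a \<Rightarrow> real) \<Rightarrow> ('a \<Rightarrow> real) \<Rightarrow> 'a \<Rightarrow> bool" where
  "raised A a \<psi> \<psi>' y \<longleftrightarrow> y \<in> A \<and> \<psi>' y = max a (\<psi> y) \<and> ((\<exists>p\<in>A \<inter> C. \<psi> p < a) \<longrightarrow> \<psi> y < a)"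

text \<open>Adding \<open>max 0 (a - \<psi> y)\<close> to \<open>\<psi> y\<close> gives
  \<open>max a (\<psi> y)\<close>, and \<open>one_step\<close> provides a slow function with this
  value at \<open>y\<close> and the analogous one at \<open>(h ^^ n) y\<close>.\<close>

lemma raised_step:
  assumes A: "open A" "A \<inter> C \<noteq> {}" and B: "open B" "B \<inter> C \<noteq> {}"
    and \<psi>: "continuous_on C \<psi>" "\<And>z. z \<in> C \<Longrightarrow> 0 \<le> \<psi> z"
    and Q: "finite Q" "Q \<subseteq> C" and "0 < \<delta>"
  obtains \<psi>' y n where "continuous_on C \<psi>'" "\<And>z. z \<in> C \<Longrightarrow> \<psi> z \<le> \<psi>' z"
    "\<And>z. z \<in> Q \<Longrightarrow> \<psi>' z = \<psi> z"
    "\<And>z. z \<in> C \<Longrightarrow> \<bar>(\<psi>' (h z) - \<psi>' z) - (\<psi> (h z) - \<psi> z)\<bar> \<le> \<delta>"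
    "y \<in> periodic_points C h" "n > 0" "raised A a \<psi> \<psi>' y" "raised B b \<psi> \<psi>' ((h ^^ n) y)"
proof -
  \<comment> \<open>If \<open>\<psi> < a\<close> occurs in the open set, the visit is confined to
    the open part where it holds; otherwise the whole set is kept.\<close>
  have shrink: "\<exists>A'. openin (top_of_set C) A' \<and> A' \<noteq> {} \<and> A' \<subseteq> A \<inter> C \<and>
      ((\<exists>p\<in>A \<inter> C. \<psi> p < a) \<longrightarrow> (\<forall>p\<in>A'. \<psi> p < a))" if "open A" "A \<inter> C \<noteq> {}" for A and a :: real
  proof (cases "\<exists>p\<in>A \<inter> C. \<psi> p < a")
    case True
    have "openin (top_of_set C) ({x \<in> C. \<psi> x < a} \<inter> A)"
      by (simp add: openin_Int_open openin_continuous_less \<psi> that)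
    then show ?thesis
      using True by (intro exI[of _ "{x \<in> C. \<psi> x < a} \<inter> A"]) auto
  next
    case False
    then show ?thesis
      using that by (intro exI[of _ "C \<inter> A"]) (auto simp: openin_open_Int)
  qed
  obtain A' where A': "openin (top_of_set C) A'" "A' \<noteq> {}" "A' \<subseteq> A \<inter> C"
      "(\<exists>p\<in>A \<inter> C. \<psi> p < a) \<longrightarrow> (\<forall>p\<in>A'. \<psi> p < a)"
    using shrink[OF A, of a] by auto
  obtain B' where B': "openin (top_of_set C) B'" "B' \<noteq> {}" "B' \<subseteq> B \<inter> C"
      "(\<exists>p\<in>B \<inter> C. \<psi> p < b) \<longrightarrow> (\<forall>p\<in>B'. \<psi> p < b)"
    using shrink[OF B, of b] by auto
  obtain u y n where u: "continuous_on C u" "\<And>z. z \<in> C \<Longrightarrow> 0 \<le> u z"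
    "\<And>z. z \<in> Q \<Longrightarrow> u z = 0" "\<And>z. z \<in> C \<Longrightarrow> \<bar>u (h z) - u z\<bar> \<le> \<delta>"
    and y: "y \<in> A'" "(h ^^ n) y \<in> B'" "n > 0" "y \<in> periodic_points C h"
    and uy: "u y = max 0 (a - \<psi> y)" "u ((h ^^ n) y) = max 0 (b - \<psi> ((h ^^ n) y))"
  proof (rule one_step[OF A'(1,2) B'(1,2) Q \<open>0 < \<delta>\<close>,
        of "\<lambda>z. max 0 (a - \<psi> z)" "max 0 (max a b)" "\<lambda>z. max 0 (b - \<psi> z)"])
    show "0 \<le> max 0 (a - \<psi> z) \<and> max 0 (a - \<psi> z) \<le> max 0 (max a b)"
      "0 \<le> max 0 (b - \<psi> z) \<and> max 0 (b - \<psi> z) \<le> max 0 (max a b)" if "z \<in> C" for z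
      using \<psi>(2)[OF that] by auto
  qed (rule that)
  show thesis
  proof (rule that[of "\<lambda>z. \<psi> z + u z" y n])
    show "\<bar>\<psi> (h z) + u (h z) - (\<psi> z + u z) - (\<psi> (h z) - \<psi> z)\<bar> \<le> \<delta>" if "z \<in> C" for z
      using u(4)[OF that] by (simp add: algebra_simps)
    show "raised A a \<psi> (\<lambda>z. \<psi> z + u z) y"
      using y(1) A'(3,4) uy(1) by (auto simp: raised_def max_def)
    show "raised B b \<psi> (\<lambda>z. \<psi> z + u z) ((h ^^ n) y)"
      using y(2) B'(3,4) uy(2) by (auto simp: raised_def max_def)
  qed (use u y \<psi> in \<open>auto intro!: continuous_on_add\<close>)
qed

section \<open>Meeting all requirements in turn\<close>

text \<open>Requirements for basic open sets and rational heights suffice, so there are countably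
  many and stage \<open>k\<close> treats the \<open>k\<close>-th one. Points used at a stage are
  frozen afterwards, so meeting each requirement once is enough.\<close>

lemma raised_sequence:
  obtains \<psi> :: "nat \<Rightarrow> 'a \<Rightarrow> real" where "\<And>k. continuous_on C (\<psi> k)" "\<And>k z. z \<in> C \<Longrightarrow> 0 \<le> \<psi> k z"
    "\<And>k z. z \<in> C \<Longrightarrow> \<psi> k z \<le> \<psi> (Suc k) z"
    "\<And>k z. z \<in> C \<Longrightarrow>
       \<bar>(\<psi> (Suc k) (h z) - \<psi> (Suc k) z) - (\<psi> k (h z) - \<psi> k z)\<bar> \<le> (1/2) ^ k"
    "\<And>A B p q a b. \<lbrakk>open A; p \<in> A \<inter> C; open B; q \<in> B \<inter> C; a \<in> \<rat>; b \<in> \<rat>\<rbrakk> \<Longrightarrow>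
       \<exists>k. \<exists>y\<in>periodic_points C h. \<exists>n>0. y \<in> A \<and> (h ^^ n) y \<in> B \<and>
         (\<psi> k p < a \<longrightarrow> \<psi> k y < a) \<and> (\<psi> k q < b \<longrightarrow> \<psi> k ((h ^^ n) y) < b) \<and>
         (\<forall>j>k. \<psi> j y = max a (\<psi> k y) \<and> \<psi> j ((h ^^ n) y) = max b (\<psi> k ((h ^^ n) y)))"
proof -
  obtain \<B> :: "'a set set" where \<B>: "countable \<B>" "topological_basis \<B>"
    using ex_countable_basis by blast
  define \<B>' where "\<B>' = {A \<in> \<B>. A \<inter> C \<noteq> {}}"
  define S where "S = \<B>' \<times> \<B>' \<times> (\<rat> :: real set) \<times> (\<rat> :: real set)"
  have "countable S"
    using \<B>(1) by (auto simp: S_def \<B>'_def countable_rat)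
  have basis: "\<exists>A'\<in>\<B>'. p \<in> A' \<and> A' \<subseteq> A" if "open A" "p \<in> A \<inter> C" for A p
  proof -
    obtain A' where "A' \<in> \<B>" "p \<in> A'" "A' \<subseteq> A"
      using topological_basisE[OF \<B>(2) \<open>open A\<close>, of p] \<open>p \<in> A \<inter> C\<close> by blast
    then show ?thesis
      using that(2) by (auto simp: \<B>'_def)
  qed
  have "S \<noteq> {}"
    using basis[of UNIV] nonempty Rats_0 unfolding S_def by fastforce
  define r where "r = from_nat_into S"
  have r_in: "r k \<in> S" for k
    unfolding r_def by (rule from_nat_into[OF \<open>S \<noteq> {}\<close>])
  have r_surj: "\<exists>k. r k = x" if "x \<in> S" for x
    unfolding r_def using from_nat_into_surj[OF \<open>countable S\<close> that] by blast
  \<comment> \<open>A state pairs the current exponent with the finite set of frozen points;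
    \<open>P\<close> is the invariant and \<open>N\<close> the transition that treats
    \<open>r k\<close>.\<close>
  define P where "P k s \<longleftrightarrow> continuous_on C (fst s) \<and> (\<forall>z\<in>C. 0 \<le> fst s z) \<and>
      finite (snd s) \<and> snd s \<subseteq> C" for k :: nat and s :: "('a \<Rightarrow> real) \<times> 'a set"
  define N where "N k s s' \<longleftrightarrow> (\<forall>z\<in>C. fst s z \<le> fst s' z) \<and> (\<forall>z\<in>snd s. fst s' z = fst s z) \<and>
      snd s \<subseteq> snd s' \<and>
      (\<forall>z\<in>C. \<bar>(fst s' (h z) - fst s' z) - (fst s (h z) - fst s z)\<bar> \<le> (1/2) ^ k) \<and>
      (\<forall>A B a b. r k = (A, B, a, b) \<longrightarrow>
        (\<exists>y\<in>periodic_points C h. \<exists>n>0. raised A a (fst s) (fst s') y \<and>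
          raised B b (fst s) (fst s') ((h ^^ n) y) \<and> y \<in> snd s' \<and> (h ^^ n) y \<in> snd s'))"
    for k and s s' :: "('a \<Rightarrow> real) \<times> 'a set"
  have "\<exists>s. \<forall>k. P k (s k) \<and> N k (s k) (s (Suc k))"
  proof (rule dependent_nat_choice)
    show "\<exists>s. P 0 s"
      by (rule exI[of _ "(\<lambda>_. 0, {})"]) (auto simp: P_def)
  next
    fix s k
    assume "P k s"
    then have s: "continuous_on C (fst s)" "\<And>z. z \<in> C \<Longrightarrow> 0 \<le> fst s z" "finite (snd s)" "snd s \<subseteq> C"
      by (auto simp: P_def)
    obtain A B a b where rk: "r k = (A, B, a, b)"
      by (cases "r k") auto
    have AB: "open A" "A \<inter> C \<noteq> {}" "open B" "B \<inter> C \<noteq> {}"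
      using r_in[of k] rk topological_basis_open[OF \<B>(2)] by (auto simp: S_def \<B>'_def)
    obtain \<psi>' y n where \<psi>': "continuous_on C \<psi>'" "\<And>z. z \<in> C \<Longrightarrow> fst s z \<le> \<psi>' z"
      "\<And>z. z \<in> snd s \<Longrightarrow> \<psi>' z = fst s z"
      "\<And>z. z \<in> C \<Longrightarrow> \<bar>(\<psi>' (h z) - \<psi>' z) - (fst s (h z) - fst s z)\<bar> \<le> (1/2) ^ k"
      and y: "y \<in> periodic_points C h" "n > 0" "raised A a (fst s) \<psi>' y"
        "raised B b (fst s) \<psi>' ((h ^^ n) y)"
      using raised_step[OF AB s, of "(1/2) ^ k" a b]
      by (metis zero_less_divide_1_iff zero_less_numeral zero_less_power)
    have "y \<in> C"
      using y(1) by (simp add: periodic_points_def)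
    then have "(h ^^ n) y \<in> C"
      by (rule funpow_h_in)
    moreover have "0 \<le> \<psi>' z" if "z \<in> C" for z
      using s(2)[OF that] \<psi>'(2)[OF that] by linarith
    ultimately have "P (Suc k) (\<psi>', insert y (insert ((h ^^ n) y) (snd s)))"
      using s(3,4) \<psi>'(1) \<open>y \<in> C\<close> by (simp add: P_def)
    moreover have "N k s (\<psi>', insert y (insert ((h ^^ n) y) (snd s)))"
      using \<psi>' y rk by (auto simp: N_def)
    ultimately show "\<exists>s'. P (Suc k) s' \<and> N k s s'"
      by blast
  qed
  then obtain s where s: "\<And>k. P k (s k)" "\<And>k. N k (s k) (s (Suc k))"
    by blast
  define \<psi> where "\<psi> k = fst (s k)" for k
  show thesis
  proof (rule that[of \<psi>])
    show "continuous_on C (\<psi> k)" for k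
      using s(1)[of k] by (simp add: P_def \<psi>_def)
    show "0 \<le> \<psi> k z" if "z \<in> C" for k z
      using s(1)[of k] that by (simp add: P_def \<psi>_def)
    show "\<psi> k z \<le> \<psi> (Suc k) z" if "z \<in> C" for k z
      using s(2)[of k] that by (simp add: N_def \<psi>_def)
    show "\<bar>(\<psi> (Suc k) (h z) - \<psi> (Suc k) z) - (\<psi> k (h z) - \<psi> k z)\<bar> \<le> (1/2) ^ k"
      if "z \<in> C" for k z
      using s(2)[of k] that by (simp add: N_def \<psi>_def)
    fix A B p q and a b :: real
    assume asm: "open A" "p \<in> A \<inter> C" "open B" "q \<in> B \<inter> C" "a \<in> \<rat>" "b \<in> \<rat>"
    obtain A' where A': "A' \<in> \<B>'" "p \<in> A'" "A' \<subseteq> A"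
      using basis[OF asm(1,2)] by auto
    obtain B' where B': "B' \<in> \<B>'" "q \<in> B'" "B' \<subseteq> B"
      using basis[OF asm(3,4)] by auto
    obtain k where k: "r k = (A', B', a, b)"
      using r_surj[of "(A', B', a, b)"] A' B' asm by (auto simp: S_def)
    obtain y n where y: "y \<in> periodic_points C h" "n > 0"
      "raised A' a (\<psi> k) (\<psi> (Suc k)) y" "raised B' b (\<psi> k) (\<psi> (Suc k)) ((h ^^ n) y)"
      "y \<in> snd (s (Suc k))" "(h ^^ n) y \<in> snd (s (Suc k))"
      using s(2)[of k] k unfolding N_def \<psi>_def by blast
    have frozen: "\<psi> j z = \<psi> (Suc k) z" if "j > k" "z \<in> snd (s (Suc k))" for j z
    proof -
      have "z \<in> snd (s j) \<and> \<psi> j z = \<psi> (Suc k) z"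
        using Suc_leI[OF that(1)]
      proof (induction j rule: dec_induct)
        case base
        then show ?case
          using that by simp
      next
        case (step j)
        then show ?case
          using s(2)[of j] by (auto simp: N_def \<psi>_def)
      qed
      then show ?thesis
        by simp
    qed
    have "y \<in> A" "(h ^^ n) y \<in> B" "\<psi> k p < a \<longrightarrow> \<psi> k y < a" "\<psi> k q < b \<longrightarrow> \<psi> k ((h ^^ n) y) < b"
      using y(3,4) A'(2,3) B'(2,3) asm(2,4) by (auto simp: raised_def)
    moreover have "\<psi> j y = max a (\<psi> k y) \<and> \<psi> j ((h ^^ n) y) = max b (\<psi> k ((h ^^ n) y))" if "j > k" for j
      using frozen[OF that y(5)] frozen[OF that y(6)] y(3,4) by (simp add: raised_def)
    ultimately show "\<exists>k. \<exists>y\<in>periodic_points C h. \<exists>n>0. y \<in> A \<and> (h ^^ n) y \<in> B \<and>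
         (\<psi> k p < a \<longrightarrow> \<psi> k y < a) \<and> (\<psi> k q < b \<longrightarrow> \<psi> k ((h ^^ n) y) < b) \<and>
         (\<forall>j>k. \<psi> j y = max a (\<psi> k y) \<and> \<psi> j ((h ^^ n) y) = max b (\<psi> k ((h ^^ n) y)))"
      using y(1,2) by blast
  qed
qed

section \<open>The limit weight and its multiplier\<close>

theorem exists_weight:
  obtains \<phi> c :: "'a \<Rightarrow> real" where "upper_semicont_on C \<phi>" "\<And>z. z \<in> C \<Longrightarrow> 0 \<le> \<phi> z \<and> \<phi> z \<le> 1"
    "continuous_on C c" "\<And>z. z \<in> C \<Longrightarrow> 0 < c z" "\<And>z. z \<in> C \<Longrightarrow> \<phi> (h z) = c z * \<phi> z"
    "\<And>p q s r \<epsilon>. \<lbrakk>p \<in> C; q \<in> C; 0 \<le> s; s \<le> \<phi> p; 0 \<le> r; r \<le> \<phi> q; 0 < \<epsilon>\<rbrakk> \<Longrightarrow>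
       \<exists>y\<in>periodic_points C h. \<exists>n>0. 0 < \<phi> y \<and> dist y p < \<epsilon> \<and> \<bar>\<phi> y - s\<bar> < \<epsilon> \<and>
         dist ((h ^^ n) y) q < \<epsilon> \<and> \<bar>\<phi> ((h ^^ n) y) - r\<bar> < \<epsilon>"
proof -
  obtain \<psi> :: "nat \<Rightarrow> 'a \<Rightarrow> real" where cont: "\<And>k. continuous_on C (\<psi> k)" and nonneg: "\<And>k z. z \<in> C \<Longrightarrow> 0 \<le> \<psi> k z"
    and mono: "\<And>k z. z \<in> C \<Longrightarrow> \<psi> k z \<le> \<psi> (Suc k) z"
    and slow: "\<And>k z. z \<in> C \<Longrightarrow>
       \<bar>(\<psi> (Suc k) (h z) - \<psi> (Suc k) z) - (\<psi> k (h z) - \<psi> k z)\<bar> \<le> (1/2) ^ k"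
    and dense: "\<And>A B p q a b. \<lbrakk>open A; p \<in> A \<inter> C; open B; q \<in> B \<inter> C; a \<in> \<rat>; b \<in> \<rat>\<rbrakk> \<Longrightarrow>
       \<exists>k. \<exists>y\<in>periodic_points C h. \<exists>n>0. y \<in> A \<and> (h ^^ n) y \<in> B \<and>
         (\<psi> k p < a \<longrightarrow> \<psi> k y < a) \<and> (\<psi> k q < b \<longrightarrow> \<psi> k ((h ^^ n) y) < b) \<and>
         (\<forall>j>k. \<psi> j y = max a (\<psi> k y) \<and> \<psi> j ((h ^^ n) y) = max b (\<psi> k ((h ^^ n) y)))"
    using raised_sequence by blast
  \<comment> \<open>An infimum of continuous functions is upper semicontinuous. By monotonicity it
    is also the pointwise limit, with value 0 where the exponents are unbounded.\<close>
  define \<phi> where "\<phi> z = (INF k. exp (- \<psi> k z))" for z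
  have bdd: "bdd_below (range (\<lambda>k. exp (- \<psi> k z)))" for z
    by (rule bdd_belowI[of _ 0]) auto
  have \<phi>_le: "\<phi> z \<le> exp (- \<psi> k z)" for z k
    unfolding \<phi>_def by (rule cINF_lower[OF bdd]) simp
  have \<phi>_nonneg: "0 \<le> \<phi> z" for z
    unfolding \<phi>_def by (rule cINF_greatest) auto
  have \<phi>_le_1: "\<phi> z \<le> 1" if "z \<in> C" for z
    using \<phi>_le[of z 0] nonneg[OF that, of 0] by (smt (verit) exp_le_one_iff)
  have lim: "(\<lambda>k. exp (- \<psi> k z)) \<longlonglongrightarrow> \<phi> z" if "z \<in> C" for z
    unfolding \<phi>_def using mono[OF that] by (intro LIMSEQ_decseq_INF[OF bdd] decseq_SucI) simp
  have frozen: "\<phi> z = exp (- x)" if "z \<in> C" "\<And>j. j > k \<Longrightarrow> \<psi> j z = x" for z k x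
  proof (rule LIMSEQ_unique[OF lim[OF that(1)]])
    have "\<forall>\<^sub>F j in sequentially. exp (- \<psi> j z) = exp (- x)"
      using eventually_gt_at_top[of k] by eventually_elim (simp add: that(2))
    then show "(\<lambda>j. exp (- \<psi> j z)) \<longlonglongrightarrow> exp (- x)"
      by (rule tendsto_eventually)
  qed
  \<comment> \<open>The increments of \<open>D\<close> are bounded by a geometric series, so
    \<open>D n - D 0\<close> converges uniformly although the exponents themselves need not
    converge.\<close>
  define D where "D k z = \<psi> k (h z) - \<psi> k z" for k z
  define E where "E z = (\<Sum>k. D (Suc k) z - D k z)" for z
  have "uniform_limit C (\<lambda>n z. \<Sum>k<n. D (Suc k) z - D k z) E sequentially"
    unfolding E_def by (rule Weierstrass_m_test[where M = "\<lambda>k. (1/2) ^ k"])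
      (use slow in \<open>auto simp: D_def summable_geometric\<close>)
  then have unif: "uniform_limit C (\<lambda>n z. D n z - D 0 z) E sequentially"
    by (simp add: sum_lessThan_telescope[of "\<lambda>k. D k z" for z])
  have contD: "continuous_on C (D k)" for k
    unfolding D_def
    using continuous_on_compose2[OF cont continuous_h] h_in cont by (auto intro!: continuous_on_diff)
  have "continuous_on C E"
    by (rule uniform_limit_theorem[OF _ unif]) (auto intro!: always_eventually continuous_on_diff contD)
  \<comment> \<open>This is the limit of \<open>exp (- D n z)\<close>. The initial exponent
    \<open>\<psi> 0\<close> is only known to be continuous and nonnegative, so \<open>D 0\<close>
    has to be added back.\<close>
  define c where "c z = exp (- (E z + D 0 z))" for z
  show thesis
  proof (rule that[of \<phi> c])
    show "upper_semicont_on C \<phi>"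
      unfolding upper_semicont_on_def
    proof
      fix a
      have "{x \<in> C. \<phi> x < a} = (\<Union>k. {x \<in> C. exp (- \<psi> k x) < a})"
        unfolding \<phi>_def using cINF_less_iff[OF _ bdd] by auto
      also have "openin (top_of_set C) \<dots>"
        using openin_continuous_less[OF continuous_on_exp[OF continuous_on_minus[OF cont]]]
        by (intro openin_Union) auto
      finally show "openin (top_of_set C) {x \<in> C. \<phi> x < a}" .
    qed
    show "continuous_on C c"
      unfolding c_def by (intro continuous_intros \<open>continuous_on C E\<close> contD)
    show "\<phi> (h z) = c z * \<phi> z" if "z \<in> C" for z
    proof (rule LIMSEQ_unique[OF lim[OF h_in[OF that]]])
      have "(\<lambda>n. D n z - D 0 z) \<longlonglongrightarrow> E z"
        using tendsto_uniform_limitI[OF unif that] .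
      then have "(\<lambda>n. exp (- ((D n z - D 0 z) + D 0 z)) * exp (- \<psi> n z)) \<longlonglongrightarrow> c z * \<phi> z"
        unfolding c_def by (intro tendsto_intros lim that)
      then show "(\<lambda>n. exp (- \<psi> n (h z))) \<longlonglongrightarrow> c z * \<phi> z"
        by (simp add: D_def flip: exp_add)
    qed
    fix p q s r and \<epsilon> :: real
    assume asm: "p \<in> C" "q \<in> C" "0 \<le> s" "s \<le> \<phi> p" "0 \<le> r" "r \<le> \<phi> q" "0 < \<epsilon>"
    obtain a where a: "a \<in> \<rat>" "\<bar>exp (- a) - s\<bar> < \<epsilon>" "0 < s \<Longrightarrow> exp (- a) < s"
      using exists_rational_exponent[OF asm(3) order_trans[OF asm(4) \<phi>_le_1[OF asm(1)]] asm(7)]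
      by blast
    obtain b where b: "b \<in> \<rat>" "\<bar>exp (- b) - r\<bar> < \<epsilon>" "0 < r \<Longrightarrow> exp (- b) < r"
      using exists_rational_exponent[OF asm(5) order_trans[OF asm(6) \<phi>_le_1[OF asm(2)]] asm(7)]
      by blast
    obtain k y n where y: "y \<in> periodic_points C h" "n > 0" "y \<in> ball p \<epsilon>" "(h ^^ n) y \<in> ball q \<epsilon>"
      "\<psi> k p < a \<Longrightarrow> \<psi> k y < a" "\<psi> k q < b \<Longrightarrow> \<psi> k ((h ^^ n) y) < b"
      "\<And>j. j > k \<Longrightarrow> \<psi> j y = max a (\<psi> k y)"
      "\<And>j. j > k \<Longrightarrow> \<psi> j ((h ^^ n) y) = max b (\<psi> k ((h ^^ n) y))"
      using dense[of "ball p \<epsilon>" p "ball q \<epsilon>" q a b] asm a(1) b(1) by auto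
    have "y \<in> C"
      using y(1) by (simp add: periodic_points_def)
    \<comment> \<open>For positive \<open>s\<close>,
      \<open>exp (- a) < s \<le> \<phi> p \<le> exp (- \<psi> k p)\<close> gives
      \<open>\<psi> k p < a\<close>, and the height is exactly \<open>exp (- a)\<close>. For
      \<open>s = 0\<close> a larger exponent only brings the height closer to 0.\<close>
    have close: "\<bar>exp (- max a (\<psi> k x)) - s\<bar> < \<epsilon>"
      if "0 \<le> s" "s \<le> \<phi> p" "\<bar>exp (- a) - s\<bar> < \<epsilon>" "0 < s \<Longrightarrow> exp (- a) < s" "\<psi> k p < a \<Longrightarrow> \<psi> k x < a"
      for a s p x
    proof (cases "0 < s")
      case True
      then have "exp (- a) < exp (- \<psi> k p)"
        using that(2,4) \<phi>_le[of p k] by linarith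
      then have "\<psi> k x < a"
        using that(5) by simp
      then show ?thesis
        using that(3) by (simp add: max_def)
    next
      case False
      have "exp (- max a (\<psi> k x)) \<le> exp (- a)"
        by simp
      then show ?thesis
        using False that(1,3) by (smt (verit) exp_gt_zero)
    qed
    \<comment> \<open>Being exponentials, these heights are positive.\<close>
    have "\<phi> y = exp (- max a (\<psi> k y))"
      "\<phi> ((h ^^ n) y) = exp (- max b (\<psi> k ((h ^^ n) y)))"
      using frozen[OF \<open>y \<in> C\<close> y(7)] frozen[OF funpow_h_in[OF \<open>y \<in> C\<close>] y(8)] by auto
    then show "\<exists>y\<in>periodic_points C h. \<exists>n>0. 0 < \<phi> y \<and> dist y p < \<epsilon> \<and> \<bar>\<phi> y - s\<bar> < \<epsilon> \<and>
         dist ((h ^^ n) y) q < \<epsilon> \<and> \<bar>\<phi> ((h ^^ n) y) - r\<bar> < \<epsilon>"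
      using y(1-4) close[OF asm(3,4) a(2,3) y(5)] close[OF asm(5,6) b(2,3) y(6)]
      by (intro bexI[of _ y] exI[of _ n]) (auto simp: dist_commute)
  qed (auto simp: \<phi>_nonneg \<phi>_le_1 c_def)
qed

end

section \<open>The Cantor set is perfect\<close>

lemma cantor_set_islimpt: "x islimpt cantor_set" if x: "x \<in> cantor_set"
proof -
  obtain d :: "nat \<Rightarrow> real" where d: "\<And>n. d n \<in> {0, 2}" "x = (\<Sum>n. d n / 3 ^ Suc n)"
    using x by (auto simp: cantor_set_def)
  have summable: "summable (\<lambda>n. d n / 3 ^ Suc n)"
  proof (rule summable_comparison_test')
    show "summable (\<lambda>n. (1/3::real) ^ n)"
      by (simp add: summable_geometric)
    fix n :: nat
    show "norm (d n / 3 ^ Suc n) \<le> (1/3) ^ n"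
      using d(1)[of n] by (auto simp: field_simps)
  qed
  show ?thesis
    unfolding islimpt_approachable
  proof (intro allI impI)
    fix e :: real
    assume "e > 0"
    obtain m where m: "(1/3::real) ^ m < e"
      using real_arch_pow_inv[OF \<open>e > 0\<close>, of "1/3"] by auto
    \<comment> \<open>Swapping the digits 0 and 2 at place \<open>m\<close> moves the point by
      exactly \<open>2 / 3 ^ Suc m\<close>.\<close>
    define d' where "d' n = (if n = m then 2 - d n else d n)" for n
    define y where "y = (\<Sum>n. d' n / 3 ^ Suc n)"
    have "d' n \<in> {0, 2}" for n
      using d(1)[of n] by (auto simp: d'_def)
    then have "y \<in> cantor_set"
      unfolding cantor_set_def y_def by blast
    have "(\<lambda>n. d n / 3 ^ Suc n + (if n = m then (2 - 2 * d n) / 3 ^ Suc n else 0))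
        sums (x + (2 - 2 * d m) / 3 ^ Suc m)"
      unfolding d(2) by (intro sums_add summable_sums summable sums_single)
    moreover have "(\<lambda>n. d n / 3 ^ Suc n + (if n = m then (2 - 2 * d n) / 3 ^ Suc n else 0))
        = (\<lambda>n. d' n / 3 ^ Suc n)"
      by (auto simp: d'_def fun_eq_iff field_simps)
    ultimately have "y = x + (2 - 2 * d m) / 3 ^ Suc m"
      by (simp add: y_def sums_iff)
    moreover have "\<bar>2 - 2 * d m\<bar> = 2"
      using d(1)[of m] by auto
    ultimately have dist: "dist y x = 2 / 3 ^ Suc m"
      by (simp add: dist_real_def)
    also have "\<dots> < (1/3) ^ m"
      by (simp add: field_simps)
    finally have "dist y x < e"
      using m by simp
    moreover have "y \<noteq> x"
      using dist by auto
    ultimately show "\<exists>x'\<in>cantor_set. x' \<noteq> x \<and> dist x' x < e"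
      using \<open>y \<in> cantor_set\<close> by blast
  qed
qed

lemma cantor_set_nonempty: "cantor_set \<noteq> {}"
  by (auto simp: cantor_set_def intro!: exI[of _ "\<lambda>_. 0"])

section \<open>The Lelek fence and its chaotic homeomorphism\<close>

theorem theorem7p2:
  fixes h :: "real \<Rightarrow> real"
  assumes "\<exists>g. homeomorphism cantor_set cantor_set h g"
    and "chaotic_on cantor_set h"
  shows "\<exists>phiL phiU (hh :: real \<times> real \<Rightarrow> real \<times> real).
           admissible_pair phiL phiU \<and> lelek_fence phiL phiU \<and>
           (\<exists>gg. homeomorphism (fence phiL phiU) (fence phiL phiU) hh gg) \<and>
           chaotic_on (fence phiL phiU) hh \<and>
           (\<forall>(y, t) \<in> fence phiL phiU. fst (hh (y, t)) = h y)"
proof -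
  obtain g where g: "homeomorphism cantor_set cantor_set h g"
    using assms(1) by blast
  interpret chaotic_homeomorphism cantor_set h g
    by standard (use g assms(2) cantor_set_islimpt cantor_set_nonempty in auto)
  obtain \<phi> c where usc: "upper_semicont_on cantor_set \<phi>"
    and \<phi>: "\<And>z. z \<in> cantor_set \<Longrightarrow> 0 \<le> \<phi> z \<and> \<phi> z \<le> 1"
    and c: "continuous_on cantor_set c" "\<And>z. z \<in> cantor_set \<Longrightarrow> 0 < c z"
    and \<phi>_h: "\<And>z. z \<in> cantor_set \<Longrightarrow> \<phi> (h z) = c z * \<phi> z"
    and dense: "\<And>p q s r \<epsilon>. \<lbrakk>p \<in> cantor_set; q \<in> cantor_set; 0 \<le> s; s \<le> \<phi> p; 0 \<le> r; r \<le> \<phi> q; 0 < \<epsilon>\<rbrakk> \<Longrightarrow>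
       \<exists>y\<in>periodic_points cantor_set h. \<exists>n>0. 0 < \<phi> y \<and> dist y p < \<epsilon> \<and> \<bar>\<phi> y - s\<bar> < \<epsilon> \<and>
         dist ((h ^^ n) y) q < \<epsilon> \<and> \<bar>\<phi> ((h ^^ n) y) - r\<bar> < \<epsilon>"
    using exists_weight by blast
  define F where "F = fence (\<lambda>_. 0) \<phi>"
  have F: "(y, t) \<in> F \<longleftrightarrow> y \<in> cantor_set \<and> 0 \<le> t \<and> t \<le> \<phi> y" for y t
    by (simp add: F_def fence_def)
  \<comment> \<open>On fibres \<open>hh\<close> is linear and takes the segment up to
    \<open>\<phi> y\<close> onto the one up to \<open>\<phi> (h y) = c y * \<phi> y\<close>;
    \<open>gg\<close> divides by the same factor.\<close>
  define hh where "hh = (\<lambda>(y, t). (h y, c y * t))"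
  define gg where "gg = (\<lambda>(y, t). (g y, t / c (g y)))"
  have endpoint: "(hh ^^ n) (y, \<phi> y) = ((h ^^ n) y, \<phi> ((h ^^ n) y))" if "y \<in> cantor_set" for n y
    by (induction n) (simp_all add: hh_def \<phi>_h funpow_h_in that)
  have dense_F: "\<exists>y\<in>periodic_points cantor_set h. \<exists>n>0. 0 < \<phi> y \<and> dist (y, \<phi> y) v < \<epsilon> \<and>
      dist ((h ^^ n) y, \<phi> ((h ^^ n) y)) w < \<epsilon>" if "v \<in> F" "w \<in> F" "0 < \<epsilon>" for v w \<epsilon>
  proof -
    obtain p s q r where vw: "v = (p, s)" "w = (q, r)"
      by (cases v, cases w)
    have "\<exists>y\<in>periodic_points cantor_set h. \<exists>n>0. 0 < \<phi> y \<and> dist y p < \<epsilon>/2 \<and> \<bar>\<phi> y - s\<bar> < \<epsilon>/2 \<and>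
         dist ((h ^^ n) y) q < \<epsilon>/2 \<and> \<bar>\<phi> ((h ^^ n) y) - r\<bar> < \<epsilon>/2"
      using that by (intro dense) (auto simp: vw F)
    moreover have "dist (x, t) (x', t') < \<epsilon>" if "dist x x' < \<epsilon>/2" "\<bar>t - t'\<bar> < \<epsilon>/2" for x t x' t' :: real
    proof -
      have "dist (x, t) (x', t') \<le> dist x x' + dist t t'"
        unfolding dist_Pair_Pair by (rule sqrt_sum_squares_le_sum) auto
      then show ?thesis
        using that by (simp add: dist_real_def)
    qed
    ultimately show ?thesis
      unfolding vw by meson
  qed
  have admissible: "admissible_pair (\<lambda>_. 0) \<phi>"
    using usc \<phi> by (simp add: admissible_pair_def lower_semicont_on_def openin_continuous_greater)
  have lelek: "lelek_fence (\<lambda>_. 0) \<phi>"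
    unfolding lelek_fence_def
  proof (intro conjI exI[of _ "{x \<in> cantor_set. 0 < \<phi> x}"] subsetI)
    fix x
    assume "x \<in> cantor_set"
    \<comment> \<open>Approximating the bottom point over \<open>x\<close> by graph points of
      positive height gives nearby base points where \<open>\<phi>\<close> is positive.\<close>
    then have x: "(x, 0) \<in> F"
      using \<phi> by (simp add: F)
    show "x \<in> closure {x \<in> cantor_set. 0 < \<phi> x}"
      unfolding closure_approachable
    proof (intro allI impI)
      fix e :: real
      assume "0 < e"
      obtain y where y: "y \<in> periodic_points cantor_set h" "0 < \<phi> y" "dist (y, \<phi> y) (x, 0) < e"
        using dense_F[OF x x \<open>0 < e\<close>] by blast
      then have "dist y x < e"
        using dist_fst_le[of "(y, \<phi> y)" "(x, 0)"] by simp
      then show "\<exists>y\<in>{x \<in> cantor_set. 0 < \<phi> x}. dist y x < e"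
        using y by (auto simp: periodic_points_def)
    qed
  next
    fix v
    assume "v \<in> fence (\<lambda>_. 0) \<phi>"
    then have v: "v \<in> F"
      by (simp add: F_def)
    show "v \<in> closure ((\<lambda>x. (x, \<phi> x)) ` cantor_set)"
      unfolding closure_approachable
      using dense_F[OF v v] by (fastforce simp: periodic_points_def)
  qed auto
  have hh_in: "hh v \<in> F" if "v \<in> F" for v
    using that c(2) by (cases v) (auto simp: hh_def F h_in \<phi>_h less_imp_le mult_left_mono)
  have gg_in: "gg v \<in> F" if "v \<in> F" for v
  proof (cases v)
    case (Pair y t)
    then have y: "y \<in> cantor_set" "g y \<in> cantor_set" "0 \<le> t" "t \<le> c (g y) * \<phi> (g y)"
      using that \<phi>_h[of "g y"] by (auto simp: F g_in h_g)
    then show ?thesis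
      using c(2)[of "g y"] Pair by (simp add: gg_def F pos_divide_le_eq mult.commute)
  qed
  have fst_F: "fst ` F \<subseteq> cantor_set"
    by (auto simp: F)
  have cont_fst: "continuous_on F (\<lambda>v. f (fst v))" if "continuous_on cantor_set f" for f :: "real \<Rightarrow> real"
    using continuous_on_compose2[OF that continuous_on_fst[OF continuous_on_id] fst_F] .
  have "continuous_on F hh"
    unfolding hh_def case_prod_beta
    by (intro continuous_intros cont_fst continuous_h c)
  moreover have "continuous_on F gg"
  proof -
    have "continuous_on cantor_set (\<lambda>y. c (g y))"
      using continuous_on_compose2[OF c(1) continuous_g] g_in by auto
    moreover have "c (g (fst v)) \<noteq> 0" if "v \<in> F" for v
      using that c(2)[of "g (fst v)"] g_in fst_F by force
    ultimately show ?thesis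
      unfolding gg_def case_prod_beta
      by (intro continuous_intros cont_fst[of "\<lambda>y. c (g y)"] cont_fst[OF continuous_g]) auto
  qed
  moreover have "gg (hh v) = v" "hh (gg v) = v" if "v \<in> F" for v
    using that c(2)[of "fst v"] c(2)[of "g (fst v)"]
    by (cases v, force simp: gg_def hh_def F g_h h_g g_in)+
  ultimately have homeo: "homeomorphism F F hh gg"
    using hh_in gg_in by (intro homeomorphismI) auto
  have "transitive_on F hh"
    unfolding transitive_on_def
  proof (intro allI impI, elim conjE)
    fix U V
    assume U: "openin (top_of_set F) U" "U \<noteq> {}" and V: "openin (top_of_set F) V" "V \<noteq> {}"
    obtain v d where v: "v \<in> F" "0 < d" "ball v d \<inter> F \<subseteq> U"
      using U by (metis equals0I openin_contains_ball openin_imp_subset subset_iff)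
    obtain w e where w: "w \<in> F" "0 < e" "ball w e \<inter> F \<subseteq> V"
      using V by (metis equals0I openin_contains_ball openin_imp_subset subset_iff)
    \<comment> \<open>The two approximating endpoints lie on one orbit of \<open>hh\<close>, by
      \<open>endpoint\<close>, so the first is a point of \<open>U\<close> whose \<open>n\<close>-th
      image is in \<open>V\<close>.\<close>
    obtain y n where y: "y \<in> periodic_points cantor_set h" "n > 0"
        "dist (y, \<phi> y) v < min d e" "dist ((h ^^ n) y, \<phi> ((h ^^ n) y)) w < min d e"
      using dense_F[OF v(1) w(1), of "min d e"] v(2) w(2) by auto
    have "y \<in> cantor_set"
      using y(1) by (simp add: periodic_points_def)
    then have "(y, \<phi> y) \<in> F" "((h ^^ n) y, \<phi> ((h ^^ n) y)) \<in> F"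
      using \<phi> funpow_h_in by (auto simp: F)
    then have "(y, \<phi> y) \<in> U" "(hh ^^ n) (y, \<phi> y) \<in> V"
      using v w y endpoint[OF \<open>y \<in> cantor_set\<close>] by (auto simp: dist_commute subset_iff)
    then show "\<exists>n>0. (hh ^^ n) ` U \<inter> V \<noteq> {}"
      using y(2) by blast
  qed
  moreover have "F \<subseteq> closure (periodic_points F hh)"
  proof
    fix v
    assume v: "v \<in> F"
    \<comment> \<open>When \<open>h ^^ n\<close> returns \<open>y\<close> to itself,
      \<open>endpoint\<close> shows that the height returns as well.\<close>
    have "(y, \<phi> y) \<in> periodic_points F hh" if "y \<in> periodic_points cantor_set h" for y
      using that \<phi> endpoint[of y] by (auto simp: periodic_points_def F)
    then show "v \<in> closure (periodic_points F hh)"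
      unfolding closure_approachable using dense_F[OF v v] by meson
  qed
  ultimately have "chaotic_on F hh"
    by (simp add: chaotic_on_def)
  then show ?thesis
    using admissible lelek homeo unfolding F_def
    by (intro exI[of _ "\<lambda>_. 0"] exI[of _ \<phi>] exI[of _ hh]) (auto simp: hh_def)
qed

end
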